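(* Let $\mathcal{H}$ be a separable Hilbert space, let $I$ be a countable index set, let $\{f_i\}_{i\in I}$ be a unit norm Bessel sequence in $\mathcal{H}$, and let $\epsilon>0$. Then there exists a partition $I=I_1\cup I_2$ such that, for each $j=1,2$, the sequence $\{f_i\}_{i\in I_j}$ is an $\epsilon$-perturbation of some sequence $\{g_i\}_{i\in I_j}$ in $\mathcal{H}$ which possesses a finite orthogonal decomposition.
   Context: A family $\{f_i\}_{i\in I}$ in $\mathcal{H}$ is a Bessel sequence if there is $B<\infty$ with $\sum_{i\in I}|\langle g,f_i\rangle|^2\le B\|g\|^2$ for all $g\in\mathcal{H}$; it is unit norm if $\|f_i\|=1$ for all $i\in I$. Throughout, $\operatorname{span}$ denotes the closed linear span. $\epsilon$-perturbation: given families $\{u_i\}_{i\in J}$ and $\{v_i\}_{i\in J}$ in $\mathcal{H}$ and $\epsilon>0$, the family $\{v_i\}_{i\in J}$ is an $\epsilon$-perturbation of $\{u_i\}_{i\in J}$ if $v_i\in\operatorname{span}\{u_k\}_{k\in J}$ for all $i\in J$ and $\sum_{i\in J}\|u_i-v_i\|^2\le\epsilon$. Finite orthogonal decomposition: a family $\{u_i\}_{i\in J}$ in $\mathcal{H}$ possesses a finite orthogonal decomposition if $J$ can be partitioned into finite sets $\{J_m\}_{m=1}^\infty$ such that $\operatorname{span}\{u_i\}_{i\in J}=\left(\sum_{m=1}^\infty\oplus\operatorname{span}\{u_i\}_{i\in J_m}\right)_{\ell_2}$, i.e. the subspaces $\operatorname{span}\{u_i\}_{i\in J_m}$, $m\ge1$,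 are mutually orthogonal and $\operatorname{span}\{u_i\}_{i\in J}$ is their Hilbert-space orthogonal direct sum. Countable means finite or infinite countable, and the sets of a partition are allowed to be empty. *)

theory Defs
  imports "HOL-Analysis.Analysis"
begin

text \<open>
  The distribution has real inner product spaces only. The following class of scalars covers
  \<^typ>\<open>real\<close> and \<^typ>\<open>complex\<close> simultaneously; up to isomorphism these are its only members,
  since a field with a multiplicative real norm is isomorphic to one of them (Gelfand, Mazur,
  Ostrowski) and the last axiom then determines the conjugation.
\<close>

class hilbert_scalar = real_normed_field +
  fixes scalar_cnj :: "'a \<Rightarrow> 'a"
  assumes scalar_cnj_add: "scalar_cnj (a + b) = scalar_cnj a + scalar_cnj b"
    and scalar_cnj_mult: "scalar_cnj (a * b) = scalar_cnj a * scalar_cnj b"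
    and mult_scalar_cnj: "a * scalar_cnj a = (norm a)\<^sup>2 *\<^sub>R 1"

instantiation real :: hilbert_scalar
begin
definition scalar_cnj_real :: "real \<Rightarrow> real" where "scalar_cnj_real a = a"
instance by standard (simp_all add: scalar_cnj_real_def power2_eq_square)
end

instantiation complex :: hilbert_scalar
begin
definition scalar_cnj_complex :: "complex \<Rightarrow> complex" where "scalar_cnj_complex a = cnj a"
instance by standard
    (simp_all add: scalar_cnj_complex_def scaleR_conv_of_real complex_norm_square
      del: of_real_power)
end

text \<open>
  The Hilbert space is a whole type; its norm, topology and completeness are those of the sort
  \<^class>\<open>banach\<close>. The inner product is linear in the first argument.
\<close>

locale hilbert_space = vector_space smul
  for smul :: "'k::hilbert_scalar \<Rightarrow> 'a::banach \<Rightarrow> 'a" +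
  fixes ip :: "'a \<Rightarrow> 'a \<Rightarrow> 'k"
  assumes scale_of_real: "smul (of_real r) x = r *\<^sub>R x"
    and ip_add_left: "ip (x + y) z = ip x z + ip y z"
    and ip_scale_left: "ip (smul a x) y = a * ip x y"
    and ip_scalar_cnj: "ip y x = scalar_cnj (ip x y)"
    and ip_self: "ip x x = of_real ((norm x)\<^sup>2)"

lemma hilbert_space_real:
  "hilbert_space (*\<^sub>R) (inner :: 'a::{real_inner, banach} \<Rightarrow> 'a \<Rightarrow> real)"
  by unfold_locales
    (simp_all add: algebra_simps inner_commute scalar_cnj_real_def power2_norm_eq_inner)

lemma hilbert_space_complex: "hilbert_space (*) (\<lambda>x y :: complex. x * cnj y)"
  by unfold_locales
    (simp_all add: algebra_simps scaleR_conv_of_real scalar_cnj_complex_def complex_norm_square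
      del: of_real_power)

definition separable :: "'a::topological_space set \<Rightarrow> bool" where
  "separable S \<longleftrightarrow> (\<exists>D. countable D \<and> D \<subseteq> S \<and> S \<subseteq> closure D)"

definition closed_span :: "('k::hilbert_scalar \<Rightarrow> 'a::banach \<Rightarrow> 'a) \<Rightarrow> 'a set \<Rightarrow> 'a set" where
  "closed_span smul S = closure (module.span smul S)"

lemma closed_span_real: "closed_span (*\<^sub>R) S = closure (span S)"
  by (simp add: closed_span_def span_raw_def)

definition bessel_sequence ::
    "('a::banach \<Rightarrow> 'a \<Rightarrow> 'k::hilbert_scalar) \<Rightarrow> 'i set \<Rightarrow> ('i \<Rightarrow> 'a) \<Rightarrow> bool" where
  "bessel_sequence ip I f \<longleftrightarrow>
     (\<exists>B. \<forall>g. (\<lambda>i. (norm (ip g (f i)))\<^sup>2) summable_on I \<and>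
              (\<Sum>\<^sub>\<infinity>i\<in>I. (norm (ip g (f i)))\<^sup>2) \<le> B * (norm g)\<^sup>2)"

definition unit_norm :: "'i set \<Rightarrow> ('i \<Rightarrow> 'a::real_normed_vector) \<Rightarrow> bool" where
  "unit_norm I f \<longleftrightarrow> (\<forall>i\<in>I. norm (f i) = 1)"

text \<open>In \<open>perturbation smul \<epsilon> J u v\<close> the family \<open>v\<close> is an \<open>\<epsilon>\<close>-perturbation of \<open>u\<close>.\<close>

definition perturbation ::
    "('k::hilbert_scalar \<Rightarrow> 'a::banach \<Rightarrow> 'a) \<Rightarrow> real \<Rightarrow> 'i set \<Rightarrow> ('i \<Rightarrow> 'a) \<Rightarrow> ('i \<Rightarrow> 'a) \<Rightarrow> bool"
  where
  "perturbation smul \<epsilon> J u v \<longleftrightarrow>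
     (\<forall>i\<in>J. v i \<in> closed_span smul (u ` J)) \<and>
     (\<lambda>i. (norm (u i - v i))\<^sup>2) summable_on J \<and>
     (\<Sum>\<^sub>\<infinity>i\<in>J. (norm (u i - v i))\<^sup>2) \<le> \<epsilon>"

text \<open>
  The internal \<open>\<ell>\<^sub>2\<close> sum of subspaces; it is the orthogonal direct sum only for mutually
  orthogonal subspaces, which has to be required separately.
\<close>

definition l2_sum :: "(nat \<Rightarrow> 'a::real_normed_vector set) \<Rightarrow> 'a set" where
  "l2_sum W = {x. \<exists>y. (\<forall>m. y m \<in> W m) \<and> summable (\<lambda>m. (norm (y m))\<^sup>2) \<and> y sums x}"

definition finite_orthogonal_decomposition ::
    "('k::hilbert_scalar \<Rightarrow> 'a::banach \<Rightarrow> 'a) \<Rightarrow> ('a \<Rightarrow> 'a \<Rightarrow> 'k) \<Rightarrow> 'i set \<Rightarrow> ('i \<Rightarrow> 'a) \<Rightarrow> bool"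
  where
  "finite_orthogonal_decomposition smul ip J u \<longleftrightarrow>
     (\<exists>P :: nat \<Rightarrow> 'i set.
        (\<forall>m. finite (P m)) \<and> disjoint_family P \<and> (\<Union>m. P m) = J \<and>
        (\<forall>m n. m \<noteq> n \<longrightarrow>
           (\<forall>x \<in> closed_span smul (u ` P m). \<forall>y \<in> closed_span smul (u ` P n). ip x y = 0)) \<and>
        closed_span smul (u ` J) = l2_sum (\<lambda>m. closed_span smul (u ` P m)))"

end

theory Submission
  imports Defs
begin

text \<open>
  Cut the index set into consecutive finite blocks such that, by the Bessel condition, the
  vectors outside the first \<open>k + 1\<close> blocks have projections onto the span of the first \<open>k\<close> blocks
  whose squared norms sum up to at most \<open>\<epsilon> / 2 ^ (k + 1)\<close>. Let the two parts consist of the even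
  and of the odd blocks. Within one part any two blocks are separated by a block of the other
  part, so subtracting from every vector its projection onto the span of the earlier blocks of the
  same part is an \<open>\<epsilon>\<close>-perturbation. This blockwise Gram-Schmidt process makes the blocks orthogonal
  and preserves the span.
\<close>

text \<open>Choose \<open>A\<close> with \<open>sum h A\<close> within \<open>d\<close> of the
  infinite sum. By nonnegativity a disjoint finite \<open>B\<close> cannot push
  \<open>sum h (A \<union> B)\<close> above that infinite sum, so \<open>B\<close> contributes at
  most \<open>d\<close>.\<close>

lemma summable_on_small_tail:
  fixes h :: "'i \<Rightarrow> real"
  assumes "h summable_on I" "\<And>i. i \<in> I \<Longrightarrow> 0 \<le> h i" "0 < d"
  shows "\<exists>A. finite A \<and> A \<subseteq> I \<and> (\<forall>B. finite B \<and> B \<subseteq> I - A \<longrightarrow> sum h B \<le> d)"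
proof -
  have "(sum h \<longlongrightarrow> infsum h I) (finite_subsets_at_top I)"
    using assms(1) infsum_tendsto by blast
  then have "\<forall>\<^sub>F A in finite_subsets_at_top I. dist (sum h A) (infsum h I) < d"
    using assms(3) by (rule tendstoD)
  then obtain A where A: "finite A" "A \<subseteq> I" "dist (sum h A) (infsum h I) < d"
    unfolding eventually_finite_subsets_at_top by blast
  have "sum h B \<le> d" if B: "finite B" "B \<subseteq> I - A" for B
  proof -
    have "sum h A + sum h B = sum h (A \<union> B)"
      using A B by (subst sum.union_disjoint) auto
    also have "\<dots> \<le> infsum h I"
      using A B assms by (intro finite_sum_le_infsum) auto
    finally show ?thesis
      using A(3) by (auto simp: dist_real_def)
  qed
  with A show ?thesis by blast
qed

lemma scalar_cnj_zero [simp]: "scalar_cnj 0 = (0 :: 'k::hilbert_scalar)"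
  using scalar_cnj_add[of 0 "0 :: 'k"] by simp

lemma norm_scalar_cnj [simp]: "norm (scalar_cnj a) = norm (a :: 'k::hilbert_scalar)"
proof (cases "a = 0")
  case False
  have "norm a * norm (scalar_cnj a) = (norm a)\<^sup>2"
    using arg_cong[OF mult_scalar_cnj[of a], of norm] by (simp add: norm_mult)
  with False show ?thesis by (simp add: power2_eq_square)
qed simp

section \<open>Inner products and projections onto finite orthonormal sets\<close>

context hilbert_space
begin

definition orthonormal :: "'a set \<Rightarrow> bool" where
  "orthonormal E \<longleftrightarrow> (\<forall>e\<in>E. norm e = 1) \<and> (\<forall>d\<in>E. \<forall>e\<in>E. d \<noteq> e \<longrightarrow> ip d e = 0)"

text \<open>For finite orthonormal \<open>E\<close> this is the orthogonal projection onto
  \<open>span E\<close>; for infinite \<open>E\<close> the sum defaults to 0.\<close>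

definition proj :: "'a set \<Rightarrow> 'a \<Rightarrow> 'a" where
  "proj E x = (\<Sum>e\<in>E. smul (ip x e) e)"

lemma ip_zero_left [simp]: "ip 0 x = 0"
  using ip_add_left[of 0 0 x] by simp

lemma ip_commute_zero: "ip x y = 0 \<longleftrightarrow> ip y x = 0"
  by (metis ip_scalar_cnj scalar_cnj_zero)

lemma norm_ip_commute: "norm (ip x y) = norm (ip y x)"
  by (subst ip_scalar_cnj) simp

lemma ip_diff_left: "ip (x - y) z = ip x z - ip y z"
  using ip_add_left[of "x - y" y z] by (simp add: algebra_simps)

lemma ip_add_right: "ip x (y + z) = ip x y + ip x z"
  by (metis ip_add_left ip_scalar_cnj scalar_cnj_add)

lemma ip_scale_right: "ip x (smul a y) = scalar_cnj a * ip x y"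
  by (metis ip_scale_left ip_scalar_cnj scalar_cnj_mult)

lemma ip_sum_left: "ip (sum h A) z = (\<Sum>a\<in>A. ip (h a) z)"
  by (induction A rule: infinite_finite_induct) (auto simp: ip_add_left)

lemma pythagoras:
  assumes "ip x y = 0"
  shows "(norm (x + y))\<^sup>2 = (norm x)\<^sup>2 + (norm y)\<^sup>2"
proof -
  have "ip (x + y) (x + y) = ip x x + ip y y"
    using assms ip_commute_zero[of x y] by (simp add: ip_add_left ip_add_right)
  then show ?thesis
    by (simp only: ip_self of_real_add[symmetric] of_real_eq_iff)
qed

text \<open>The locale ties scaling to the norm directly only for real scalars. The general case
  comes from the inner product, where the two factors \<open>a\<close> and
  \<open>scalar_cnj a\<close> multiply to the squared norm of \<open>a\<close>.\<close>

lemma norm_smul: "norm (smul a x) = norm a * norm x"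
proof -
  have "of_real ((norm (smul a x))\<^sup>2) = a * scalar_cnj a * ip x x"
    by (simp only: ip_self[symmetric] ip_scale_left ip_scale_right ac_simps)
  also have "\<dots> = of_real ((norm a * norm x)\<^sup>2)"
    by (simp only: mult_scalar_cnj ip_self power_mult_distrib of_real_mult)
      (simp add: of_real_def)
  finally have "(norm (smul a x))\<^sup>2 = (norm a * norm x)\<^sup>2"
    by (simp only: of_real_eq_iff)
  then show ?thesis by simp
qed

lemma orthogonal_spans:
  assumes "\<And>a b. a \<in> A \<Longrightarrow> b \<in> B \<Longrightarrow> ip a b = 0" "x \<in> span A" "y \<in> span B"
  shows "ip x y = 0"
proof -
  have *: "ip z b = 0" if "z \<in> span A" "b \<in> B" for z b
    using that(1)
  proof (induction rule: span_induct)
    case base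
    show ?case unfolding subspace_def by (auto simp: ip_add_left ip_scale_left)
  qed (use assms(1) that(2) in auto)
  \<comment> \<open>The inner product is linear in its first argument, so the second induction runs
    with the arguments swapped.\<close>
  have "ip y x = 0"
    using assms(3)
  proof (induction rule: span_induct)
    case base
    show ?case unfolding subspace_def by (auto simp: ip_add_left ip_scale_left)
  qed (use * assms(2) ip_commute_zero in blast)
  then show ?thesis by (simp add: ip_commute_zero)
qed

lemma proj_diff: "proj E (x - y) = proj E x - proj E y"
  unfolding proj_def by (simp add: ip_diff_left scale_left_diff_distrib sum_subtractf)

lemma proj_in_span: "proj E x \<in> span E"
  unfolding proj_def by (intro span_sum span_scale span_base)

lemma orthonormalD:
  assumes "orthonormal E" "d \<in> E" "e \<in> E"
  shows "ip d e = (if d = e then 1 else 0)"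
  using assms ip_self[of e] unfolding orthonormal_def by auto

lemma ip_proj_basis:
  assumes "finite E" "orthonormal E" "e \<in> E"
  shows "ip (proj E x) e = ip x e"
proof -
  have "ip (proj E x) e = (\<Sum>d\<in>E. if d = e then ip x d else 0)"
    unfolding proj_def ip_sum_left ip_scale_left
    using assms by (intro sum.cong) (auto simp: orthonormalD)
  then show ?thesis using assms by simp
qed

lemma residual_orthogonal:
  assumes "finite E" "orthonormal E" "y \<in> span E"
  shows "ip (x - proj E x) y = 0"
  by (rule orthogonal_spans[of "{x - proj E x}" E])
    (use assms in \<open>auto simp: ip_diff_left ip_proj_basis intro: span_base\<close>)

lemma norm_proj_decomposition:
  assumes "finite E" "orthonormal E"
  shows "(norm x)\<^sup>2 = (norm (x - proj E x))\<^sup>2 + (norm (proj E x))\<^sup>2"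
  using pythagoras[OF residual_orthogonal[OF assms proj_in_span], of x x] by simp

lemma norm_proj_le:
  assumes "finite E" "orthonormal E"
  shows "norm (proj E x) \<le> norm x" and "norm (x - proj E x) \<le> norm x"
proof -
  have "(norm (proj E x))\<^sup>2 \<le> (norm x)\<^sup>2" "(norm (x - proj E x))\<^sup>2 \<le> (norm x)\<^sup>2"
    unfolding norm_proj_decomposition[OF assms, of x] by simp_all
  then show "norm (proj E x) \<le> norm x" "norm (x - proj E x) \<le> norm x"
    by (auto dest: power2_le_imp_le)
qed

lemma norm_proj:
  assumes "finite E" "orthonormal E"
  shows "(norm (proj E x))\<^sup>2 = (\<Sum>e\<in>E. (norm (ip x e))\<^sup>2)"
  using assms
proof (induction E rule: finite_induct)
  case empty
  then show ?case by (simp add: proj_def)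
next
  case (insert e E)
  have on: "orthonormal E"
    using insert.prems by (auto simp: orthonormal_def)
  have "ip d e = 0" if "d \<in> E" for d
    using insert that by (auto simp: orthonormal_def)
  then have "ip (proj E x) (smul (ip x e) e) = 0"
    by (simp add: ip_scale_right proj_def ip_sum_left ip_scale_left)
  then have "(norm (proj E x + smul (ip x e) e))\<^sup>2 = (norm (proj E x))\<^sup>2 + (norm (ip x e))\<^sup>2"
    using insert.prems by (simp add: pythagoras norm_smul orthonormal_def)
  moreover have "proj (insert e E) x = proj E x + smul (ip x e) e"
    using insert.hyps by (simp add: proj_def add.commute)
  ultimately show ?case
    using insert.hyps insert.IH[OF on] by simp
qed

lemma proj_eq_self:
  assumes "finite E" "orthonormal E" "x \<in> span E"
  shows "proj E x = x"
proof -
  have "ip (x - proj E x) (x - proj E x) = 0"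
    using residual_orthogonal[OF assms(1,2)] assms(3) proj_in_span span_diff by blast
  then show ?thesis by (simp add: ip_self)
qed

text \<open>The residual \<open>x - proj E x\<close> does not change when an element of
  \<open>span E\<close> is subtracted from \<open>x\<close>. Its norm is thus at most the distance
  from \<open>x\<close> to \<open>span E\<close>, which is 0 on the closure.\<close>

lemma closed_span_orthonormal:
  assumes "finite E" "orthonormal E"
  shows "closure (span E) = span E"
proof
  show "closure (span E) \<subseteq> span E"
  proof
    fix x assume x: "x \<in> closure (span E)"
    have "norm (x - proj E x) \<le> 0 + d" if d: "0 < d" for d
    proof -
      from x d obtain s where s: "s \<in> span E" "dist s x < d"
        unfolding closure_approachable by blast
      have "x - proj E x = (x - s) - proj E (x - s)"
        using proj_eq_self[OF assms s(1)] by (simp add: proj_diff)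
      then have "norm (x - proj E x) \<le> norm (x - s)"
        using norm_proj_le(2)[OF assms, of "x - s"] by metis
      with s show ?thesis by (simp add: dist_norm norm_minus_commute)
    qed
    then have "norm (x - proj E x) \<le> 0" by (rule field_le_epsilon)
    then show "x \<in> span E" using proj_in_span[of E x] by simp
  qed
qed (rule closure_subset)

text \<open>Gram-Schmidt, one vector at a time: a vector already in the span adds nothing, any other
  contributes its normalised residual.\<close>

lemma ex_orthonormal_basis:
  assumes "finite S"
  shows "\<exists>E. finite E \<and> orthonormal E \<and> span E = span S"
  using assms
proof (induction S rule: finite_induct)
  case empty
  show ?case by (intro exI[of _ "{}"]) (simp add: orthonormal_def)
next
  case (insert a S)
  then obtain E where E: "finite E" "orthonormal E" "span E = span S" by blast
  have Sa: "span (insert a S) = span (insert a E)"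
    using E(3) by (simp add: span_insert)
  show ?case
  proof (cases "a \<in> span E")
    case True
    then have "span (insert a S) = span E" using Sa span_redundant by simp
    then show ?thesis using E(1,2) by blast
  next
    case False
    define r where "r = a - proj E a"
    define e where "e = smul (inverse (of_real (norm r))) r"
    have r0: "r \<noteq> 0"
      using False proj_in_span[of E a] by (auto simp: r_def)
    have e1: "norm e = 1"
      using r0 by (simp add: e_def norm_smul norm_inverse)
    have eE: "ip e d = 0" if "d \<in> E" for d
      using residual_orthogonal[OF E(1,2) span_base[OF that], of a]
      by (simp add: e_def r_def ip_scale_left)
    have on: "orthonormal (insert e E)"
      using E(2) e1 eE ip_commute_zero unfolding orthonormal_def by auto
    have pE: "proj E a \<in> span (insert b E)" for b
      using proj_in_span span_mono[of E "insert b E"] by blast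
    have re: "smul (of_real (norm r)) e = r"
      using r0 by (simp add: e_def)
    have "a - proj E a \<in> span (insert a E)"
      by (intro span_diff pE) (simp add: span_base)
    then have "e \<in> span (insert a E)"
      unfolding e_def r_def by (rule span_scale)
    moreover have "a \<in> span (insert e E)"
    proof -
      have "smul (of_real (norm r)) e + proj E a \<in> span (insert e E)"
        by (intro span_add span_scale pE) (simp add: span_base)
      then show ?thesis unfolding re by (simp add: r_def)
    qed
    ultimately have "span (insert e E) = span (insert a E)"
      by (intro subset_antisym span_minimal) (auto intro: span_base)
    then show ?thesis using E(1) on Sa by (intro exI[of _ "insert e E"]) simp
  qed
qed

lemma closed_span_finite:
  assumes "finite S"
  shows "closed_span smul S = span S"
proof -
  obtain E where "finite E" "orthonormal E" "span E = span S"
    using ex_orthonormal_basis[OF assms] by blast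
  then show ?thesis
    using closed_span_orthonormal[of E] by (simp add: closed_span_def)
qed

text \<open>The residual of \<open>x\<close> at \<open>D\<close> is orthogonal to \<open>E\<close>,
  so \<open>x\<close> and \<open>proj D x\<close> have the same coefficients along \<open>E\<close>.
  Hence \<open>proj E x\<close> is the projection of \<open>proj D x\<close>, and projections are
  contractions.\<close>

lemma norm_proj_mono:
  assumes "finite D" "orthonormal D" "finite E" "orthonormal E" "E \<subseteq> span D"
  shows "norm (proj E x) \<le> norm (proj D x)"
proof -
  have "ip x e = ip (proj D x) e" if "e \<in> E" for e
    using residual_orthogonal[OF assms(1,2), of e x] that assms(5)
    by (auto simp: ip_diff_left)
  then have "proj E x = proj E (proj D x)"
    unfolding proj_def[of E] by (intro sum.cong) auto
  then show ?thesis using norm_proj_le(1)[OF assms(3,4)] by metis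
qed

section \<open>Orthogonal direct sums of finite blocks\<close>

text \<open>Orthonormal bases of the blocks unite to orthonormal sets \<open>U N\<close>. The
  projections onto the spans of the \<open>U N\<close> are the partial sums of the blockwise
  projections, and they converge to every vector of the closed span.\<close>

lemma orthogonal_blocks_decomposition:
  fixes P :: "nat \<Rightarrow> 'i set" and g :: "'i \<Rightarrow> 'a"
  assumes fin: "\<And>m. finite (P m)" and disj: "disjoint_family P"
    and orth: "\<And>m n i j. m \<noteq> n \<Longrightarrow> i \<in> P m \<Longrightarrow> j \<in> P n \<Longrightarrow> ip (g i) (g j) = 0"
  shows "finite_orthogonal_decomposition smul ip (\<Union>m. P m) g"
proof -
  define W where "W m = span (g ` P m)" for m
  have cW: "closed_span smul (g ` P m) = W m" for m
    unfolding W_def using fin by (simp add: closed_span_finite)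
  have WW: "ip x y = 0" if "m \<noteq> n" "x \<in> W m" "y \<in> W n" for m n x y
    by (rule orthogonal_spans[of "g ` P m" "g ` P n"])
      (use orth that in \<open>auto simp: W_def\<close>)
  have "\<exists>E. finite E \<and> orthonormal E \<and> span E = W m" for m
    unfolding W_def using fin by (intro ex_orthonormal_basis) auto
  then obtain D where D: "\<And>m. finite (D m)" "\<And>m. orthonormal (D m)" "\<And>m. span (D m) = W m"
    by metis
  have DW: "d \<in> W m" if "d \<in> D m" for d m
    using that D(3) span_base by blast
  \<comment> \<open>A common basis vector would be orthogonal to itself. Disjointness lets sums over
    \<open>U N\<close> split into sums over the \<open>D m\<close>.\<close>
  have DD: "D m \<inter> D n = {}" if "m \<noteq> n" for m n
  proof (rule ccontr)
    assume "D m \<inter> D n \<noteq> {}"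
    then obtain d where "d \<in> D m" "d \<in> D n" by blast
    then show False
      using WW[OF that] DW orthonormalD[OF D(2)] by (metis zero_neq_one)
  qed
  define U where "U N = (\<Union>m<N. D m)" for N :: nat
  have finU: "finite (U N)" for N
    using D(1) by (auto simp: U_def)
  have onU: "orthonormal (U N)" for N
    unfolding orthonormal_def
  proof (intro conjI ballI impI)
    fix d assume "d \<in> U N"
    then show "norm d = 1" using D(2) by (auto simp: U_def orthonormal_def)
  next
    fix d e assume "d \<in> U N" "e \<in> U N" "d \<noteq> e"
    then obtain m n where "d \<in> D m" "e \<in> D n" by (auto simp: U_def)
    then show "ip d e = 0"
      using WW[of m n d e] DW orthonormalD[OF D(2), of d m e] \<open>d \<noteq> e\<close> by (cases "m = n") auto
  qed
  have projU: "proj (U N) x = (\<Sum>m<N. proj (D m) x)" for N x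
    unfolding proj_def U_def using D(1) DD by (subst sum.UNION_disjoint) auto
  have normU: "(norm (proj (U N) x))\<^sup>2 = (\<Sum>m<N. (norm (proj (D m) x))\<^sup>2)" for N x
    unfolding norm_proj[OF finU onU] norm_proj[OF D(1,2)] unfolding U_def
    using D(1) DD by (subst sum.UNION_disjoint) auto
  \<comment> \<open>The spans of the \<open>U N\<close> increase, so their union is a subspace; it
    contains every \<open>g i\<close>, hence the whole algebraic span.\<close>
  have monoU: "span (U M) \<subseteq> span (U N)" if "M \<le> N" for M N
    using that unfolding U_def by (intro span_mono UN_mono) auto
  have exU: "\<exists>N. x \<in> span (U N)" if "x \<in> span (g ` (\<Union>m. P m))" for x
    using that
  proof (induction rule: span_induct)
    case base
    show ?case
      unfolding subspace_def
    proof (intro conjI ballI allI)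
      show "0 \<in> {x. \<exists>N. x \<in> span (U N)}" using span_zero by blast
    next
      fix x y assume "x \<in> {x. \<exists>N. x \<in> span (U N)}" "y \<in> {x. \<exists>N. x \<in> span (U N)}"
      then obtain M N where "x \<in> span (U M)" "y \<in> span (U N)" by blast
      then have "x + y \<in> span (U (max M N))"
        using monoU[of M "max M N"] monoU[of N "max M N"] by (intro span_add) auto
      then show "x + y \<in> {x. \<exists>N. x \<in> span (U N)}" by blast
    next
      fix c x assume "x \<in> {x. \<exists>N. x \<in> span (U N)}"
      then show "smul c x \<in> {x. \<exists>N. x \<in> span (U N)}" using span_scale by blast
    qed
  next
    case (step x)
    then obtain m where "x \<in> W m" by (auto simp: W_def intro: span_base)
    moreover have "span (D m) \<subseteq> span (U (Suc m))"
      by (intro span_mono) (auto simp: U_def)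
    ultimately show ?case using D(3) by blast
  qed
  have "closed_span smul (g ` (\<Union>m. P m)) = l2_sum W"
  proof (intro subset_antisym subsetI)
    fix x assume x: "x \<in> closed_span smul (g ` (\<Union>m. P m))"
    \<comment> \<open>Approximate \<open>x\<close> by \<open>s\<close> in the algebraic span. Once
      \<open>span (U N)\<close> contains \<open>s\<close>, the residual of \<open>x\<close> is that
      of \<open>x - s\<close>.\<close>
    have "(\<lambda>N. proj (U N) x) \<longlonglongrightarrow> x"
    proof (rule LIMSEQ_I)
      fix d :: real assume "0 < d"
      with x obtain s where s: "s \<in> span (g ` (\<Union>m. P m))" "dist s x < d"
        unfolding closed_span_def closure_approachable by blast
      from exU[OF s(1)] obtain N0 where N0: "s \<in> span (U N0)" by blast
      have "norm (proj (U N) x - x) < d" if "N0 \<le> N" for N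
      proof -
        have "s \<in> span (U N)" using N0 monoU[OF that] by blast
        then have "x - proj (U N) x = (x - s) - proj (U N) (x - s)"
          using proj_eq_self[OF finU onU] by (simp add: proj_diff)
        then have "norm (x - proj (U N) x) \<le> norm (x - s)"
          using norm_proj_le(2)[OF finU onU, of "x - s" N] by metis
        with s show ?thesis by (simp add: dist_norm norm_minus_commute)
      qed
      then show "\<exists>N0. \<forall>N\<ge>N0. norm (proj (U N) x - x) < d" by blast
    qed
    then have "(\<lambda>m. proj (D m) x) sums x"
      by (simp add: sums_def projU)
    moreover have "summable (\<lambda>m. (norm (proj (D m) x))\<^sup>2)"
    proof (rule summableI_nonneg_bounded)
      show "(\<Sum>m<N. (norm (proj (D m) x))\<^sup>2) \<le> (norm x)\<^sup>2" for N
        using norm_proj_le(1)[OF finU onU] by (simp flip: normU)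
    qed simp
    ultimately show "x \<in> l2_sum W"
      unfolding l2_sum_def using proj_in_span[of "D _" x] D(3)
      by (intro CollectI exI[of _ "\<lambda>m. proj (D m) x"]) auto
  next
    fix x assume "x \<in> l2_sum W"
    then obtain y where y: "\<And>m. y m \<in> W m" "y sums x"
      by (auto simp: l2_sum_def)
    have "W m \<subseteq> span (g ` (\<Union>m. P m))" for m
      unfolding W_def by (intro span_mono) auto
    then have "(\<Sum>m<N. y m) \<in> span (g ` (\<Union>m. P m))" for N
      using y(1) by (intro span_sum) auto
    then show "x \<in> closed_span smul (g ` (\<Union>m. P m))"
      using y(2) unfolding closed_span_def closure_sequential sums_def
      by (intro exI[of _ "\<lambda>N. \<Sum>m<N. y m"]) auto
  qed
  then show ?thesis
    unfolding finite_orthogonal_decomposition_def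
    using fin disj WW cW by (intro exI[of _ P]) auto
qed

section \<open>Blockwise Gram-Schmidt\<close>

text \<open>The change made to a vector is its projection onto the span of the earlier blocks, so
  \<open>small\<close> bounds the perturbation block by block. It ranges over all finite orthonormal
  subsets of that span, which leaves the choice of basis to the proof.\<close>

lemma block_gram_schmidt:
  fixes P :: "nat \<Rightarrow> 'i set" and f :: "'i \<Rightarrow> 'a"
  assumes fin: "\<And>m. finite (P m)" and disj: "disjoint_family P"
    and small: "\<And>m E. finite E \<Longrightarrow> orthonormal E \<Longrightarrow> E \<subseteq> span (f ` (\<Union>k<m. P k)) \<Longrightarrow>
      (\<Sum>i\<in>P m. (norm (proj E (f i)))\<^sup>2) \<le> \<delta> m"
    and \<delta>: "\<And>N. (\<Sum>m<N. \<delta> m) \<le> \<epsilon>"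
  shows "\<exists>g. finite_orthogonal_decomposition smul ip (\<Union>m. P m) g \<and>
    perturbation smul \<epsilon> (\<Union>m. P m) g f"
proof -
  define V where "V m = (\<Union>k<m. P k)" for m
  have "\<exists>E. finite E \<and> orthonormal E \<and> span E = span (f ` V m)" for m
    unfolding V_def using fin by (intro ex_orthonormal_basis) auto
  then obtain E where E: "\<And>m. finite (E m)" "\<And>m. orthonormal (E m)"
      "\<And>m. span (E m) = span (f ` V m)"
    by metis
  \<comment> \<open>By disjointness \<open>b i\<close> is the index of the one block containing
    \<open>i\<close>; it turns the blockwise prescription into a single function
    \<open>g\<close>.\<close>
  obtain b where "\<forall>i\<in>\<Union>m. P m. i \<in> P (b i)"
    by (metis UN_E)
  then have b: "b i = m" if "i \<in> P m" for i m
    using that disj unfolding disjoint_family_on_def by blast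
  define g where "g i = f i - proj (E (b i)) (f i)" for i
  have g: "g i = f i - proj (E m) (f i)" if "i \<in> P m" for i m
    using b[OF that] by (simp add: g_def)
  have VV: "span (h ` V m) \<subseteq> span (h ` V n)" if "m \<le> n" for h :: "'i \<Rightarrow> 'a" and m n
    using that unfolding V_def by (intro span_mono image_mono UN_mono) auto
  have pf: "proj (E m) x \<in> span (f ` V m)" for m x
    using E(3) proj_in_span by blast
  have gf: "g i \<in> span (f ` V n)" if "i \<in> P m" "m < n" for i m n
    unfolding g[OF that(1)]
  proof (intro span_diff)
    show "f i \<in> span (f ` V n)" using that by (auto simp: V_def intro!: span_base)
    show "proj (E m) (f i) \<in> span (f ` V n)" using pf VV that(2) by (meson less_imp_le subsetD)
  qed
  \<comment> \<open>In the newest block, \<open>f i\<close> is \<open>g i\<close> plus a projection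
    into the span of the earlier \<open>f\<close>-vectors, which the induction hypothesis places in
    the span of the earlier \<open>g\<close>-vectors.\<close>
  have fg: "span (f ` V m) \<subseteq> span (g ` V m)" for m
  proof (induction m)
    case 0
    then show ?case by (simp add: V_def)
  next
    case (Suc m)
    have "f i \<in> span (g ` V (Suc m))" if "i \<in> P k" "k < Suc m" for i k
    proof (cases "k = m")
      case True
      have "proj (E m) (f i) \<in> span (g ` V (Suc m))"
        using pf Suc VV[of m "Suc m" g] by auto
      moreover have "g i \<in> span (g ` V (Suc m))"
        using that by (auto simp: V_def intro!: span_base)
      ultimately have "g i + proj (E m) (f i) \<in> span (g ` V (Suc m))" by (rule span_add[rotated])
      then show ?thesis using g that True by simp
    next
      case False
      with that have "i \<in> V m" by (auto simp: V_def)
      then have "f i \<in> span (f ` V m)" by (intro span_base imageI)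
      then show ?thesis using Suc VV[of m "Suc m" g] by auto
    qed
    then show ?case by (intro span_minimal) (auto simp: V_def)
  qed
  have less: "ip (g i) (g j) = 0" if "n < m" "i \<in> P m" "j \<in> P n" for m n i j
    unfolding g[OF that(2)]
    using residual_orthogonal[OF E(1,2)] gf[OF that(3,1)] E(3) by blast
  have orth: "ip (g i) (g j) = 0" if "m \<noteq> n" "i \<in> P m" "j \<in> P n" for m n i j
    using less[of n m i j] less[of m n j i] that ip_commute_zero by (meson nat_neq_iff)
  have dec: "finite_orthogonal_decomposition smul ip (\<Union>m. P m) g"
    by (rule orthogonal_blocks_decomposition[OF fin disj orth])
  have "f i \<in> closed_span smul (g ` (\<Union>m. P m))" if "i \<in> (\<Union>m. P m)" for i
  proof -
    from that obtain m where "i \<in> P m" by blast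
    then have "f i \<in> span (f ` V (Suc m))" by (auto simp: V_def intro!: span_base)
    moreover have "span (g ` V (Suc m)) \<subseteq> span (g ` (\<Union>m. P m))"
      by (intro span_mono) (auto simp: V_def)
    ultimately show ?thesis
      using fg closure_subset unfolding closed_span_def by blast
  qed
  moreover have bound: "(\<Sum>i\<in>A. (norm (g i - f i))\<^sup>2) \<le> \<epsilon>" if A: "finite A" "A \<subseteq> (\<Union>m. P m)" for A
  proof -
    \<comment> \<open>This exceeds every block index met by \<open>A\<close>. For empty
      \<open>A\<close> the unspecified \<open>Max\<close> is harmless, as the inclusion below is
      then trivial.\<close>
    define N where "N = Suc (Max (b ` A))"
    have "A \<subseteq> (\<Union>m<N. P m)"
    proof
      fix i assume i: "i \<in> A"
      then obtain m where m: "i \<in> P m" using A by blast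
      have "b i < N" using i A(1) by (simp add: N_def le_imp_less_Suc)
      then show "i \<in> (\<Union>m<N. P m)" using m b[OF m] by blast
    qed
    then have "(\<Sum>i\<in>A. (norm (g i - f i))\<^sup>2) \<le> (\<Sum>i\<in>(\<Union>m<N. P m). (norm (g i - f i))\<^sup>2)"
      using fin by (intro sum_mono2) auto
    also have "\<dots> = (\<Sum>m<N. \<Sum>i\<in>P m. (norm (g i - f i))\<^sup>2)"
      using fin disj unfolding disjoint_family_on_def by (intro sum.UNION_disjoint) auto
    also have "\<dots> = (\<Sum>m<N. \<Sum>i\<in>P m. (norm (proj (E m) (f i)))\<^sup>2)"
      by (intro sum.cong refl) (simp add: g)
    also have "\<dots> \<le> (\<Sum>m<N. \<delta> m)"
    proof (intro sum_mono small E(1,2))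
      show "E m \<subseteq> span (f ` (\<Union>k<m. P k))" for m
        using E(3)[of m] span_superset[of "E m"] by (simp add: V_def)
    qed
    finally show ?thesis using \<delta>[of N] by linarith
  qed
  moreover have "(\<lambda>i. (norm (g i - f i))\<^sup>2) summable_on (\<Union>m. P m)"
    by (rule nonneg_bounded_partial_sums_imp_summable_on[where C = \<epsilon>])
      (use bound in auto)
  ultimately have "perturbation smul \<epsilon> (\<Union>m. P m) g f"
    unfolding perturbation_def by (auto intro!: infsum_le_finite_sums)
  with dec show ?thesis by blast
qed

text \<open>For one basis \<open>D\<close> of \<open>span S\<close>, the squared norms of the
  projections are finite sums of squared coefficients, each summable by the Bessel condition, so
  they have a small tail. \<open>norm_proj_mono\<close> carries the bound over to every
  \<open>E\<close> at once.\<close>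

lemma bessel_proj_tail:
  fixes f :: "'i \<Rightarrow> 'a"
  assumes "bessel_sequence ip I f" "finite S" "0 < d"
  shows "\<exists>A. finite A \<and> A \<subseteq> I \<and> (\<forall>B E. finite B \<and> B \<subseteq> I - A \<and>
    finite E \<and> orthonormal E \<and> E \<subseteq> span S \<longrightarrow> (\<Sum>i\<in>B. (norm (proj E (f i)))\<^sup>2) \<le> d)"
proof -
  obtain D where D: "finite D" "orthonormal D" "span D = span S"
    using ex_orthonormal_basis[OF assms(2)] by blast
  have "(\<lambda>i. (norm (ip e (f i)))\<^sup>2) summable_on I" for e
    using assms(1) unfolding bessel_sequence_def by blast
  then have "(\<lambda>i. (norm (ip (f i) e))\<^sup>2) summable_on I" for e
    by (subst norm_ip_commute)
  then have "(\<lambda>i. \<Sum>e\<in>D. (norm (ip (f i) e))\<^sup>2) summable_on I"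
    by (induction D rule: infinite_finite_induct) (auto intro: summable_on_add)
  then have "(\<lambda>i. (norm (proj D (f i)))\<^sup>2) summable_on I"
    by (simp add: norm_proj[OF D(1,2)])
  from summable_on_small_tail[OF this _ assms(3)] obtain A where A: "finite A" "A \<subseteq> I"
    "\<And>B. finite B \<Longrightarrow> B \<subseteq> I - A \<Longrightarrow> (\<Sum>i\<in>B. (norm (proj D (f i)))\<^sup>2) \<le> d"
    by (meson zero_le_power2)
  have "(\<Sum>i\<in>B. (norm (proj E (f i)))\<^sup>2) \<le> d"
    if "finite B" "B \<subseteq> I - A" "finite E" "orthonormal E" "E \<subseteq> span S" for B E
  proof -
    have "(\<Sum>i\<in>B. (norm (proj E (f i)))\<^sup>2) \<le> (\<Sum>i\<in>B. (norm (proj D (f i)))\<^sup>2)"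
      using that D by (intro sum_mono power_mono norm_proj_mono) auto
    then show ?thesis using A(3)[OF that(1,2)] by linarith
  qed
  with A(1,2) show ?thesis by (intro exI[of _ A]) simp
qed

end

section \<open>Choice of the blocks and splitting by parity\<close>

theorem theorem3p1:
  fixes smul :: "'k::hilbert_scalar \<Rightarrow> 'a::banach \<Rightarrow> 'a"
    and ip :: "'a \<Rightarrow> 'a \<Rightarrow> 'k"
    and I :: "'i set"
    and f :: "'i \<Rightarrow> 'a"
    and \<epsilon> :: real
  assumes "hilbert_space smul ip"
    and "separable (UNIV :: 'a set)"
    and "countable I"
    and "bessel_sequence ip I f"
    and "unit_norm I f"
    and "\<epsilon> > 0"
  shows "\<exists>I\<^sub>1 I\<^sub>2. I = I\<^sub>1 \<union> I\<^sub>2 \<and> I\<^sub>1 \<inter> I\<^sub>2 = {} \<and>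
           (\<forall>J \<in> {I\<^sub>1, I\<^sub>2}. \<exists>g :: 'i \<Rightarrow> 'a.
              finite_orthogonal_decomposition smul ip J g \<and> perturbation smul \<epsilon> J g f)"
proof -
  interpret hilbert_space smul ip by fact
  \<comment> \<open>Finite sets exhausting \<open>I\<close> along an injection into the naturals. If
    \<open>I\<close> is finite, the later blocks simply become empty.\<close>
  define F where "F n = {i \<in> I. to_nat_on I i < n}" for n
  have finF: "finite (F n)" for n
    by (rule finite_imageD[of "to_nat_on I"])
      (auto simp: F_def intro: finite_subset[of _ "{..<n}"]
        inj_on_subset[OF inj_on_to_nat_on[OF assms(3)]])
  have monoF: "F m \<subseteq> F n" if "m \<le> n" for m n
    using that by (auto simp: F_def)
  \<comment> \<open>The requirement on a cut point \<open>b\<close> following \<open>a\<close>: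
    beyond \<open>F b\<close>, projections onto the span of \<open>F a\<close> are small in
    total.\<close>
  define tail where "tail k a b \<longleftrightarrow> (\<forall>B E. finite B \<and> B \<subseteq> I - F b \<and> finite E \<and> orthonormal E \<and>
    E \<subseteq> span (f ` F a) \<longrightarrow> (\<Sum>i\<in>B. (norm (proj E (f i)))\<^sup>2) \<le> \<epsilon> / 2 ^ Suc k)" for k a b
  have step: "\<exists>b. a < b \<and> tail k a b" for k a
  proof -
    obtain A where A: "finite A" "A \<subseteq> I" "\<forall>B E. finite B \<and> B \<subseteq> I - A \<and>
        finite E \<and> orthonormal E \<and> E \<subseteq> span (f ` F a) \<longrightarrow>
        (\<Sum>i\<in>B. (norm (proj E (f i)))\<^sup>2) \<le> \<epsilon> / 2 ^ Suc k"
      using bessel_proj_tail[OF assms(4), of "f ` F a" "\<epsilon> / 2 ^ Suc k"] finF assms(6) by auto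
    define b where "b = Suc (max a (Max (to_nat_on I ` A)))"
    have "A \<subseteq> F b"
      using A(1,2) by (auto simp: F_def b_def less_Suc_eq_le le_max_iff_disj)
    with A(3) have "tail k a b" unfolding tail_def by blast
    moreover have "a < b" by (simp add: b_def)
    ultimately show ?thesis by blast
  qed
  \<comment> \<open>Starting at 0 makes \<open>F (s 0)\<close> empty, so the differences
    \<open>C k\<close> miss no index.\<close>
  have "\<exists>s. \<forall>k. (k = 0 \<longrightarrow> s k = (0::nat)) \<and> s k < s (Suc k) \<and> tail k (s k) (s (Suc k))"
    using dependent_nat_choice[of "\<lambda>k x. k = 0 \<longrightarrow> x = (0::nat)" "\<lambda>k a b. a < b \<and> tail k a b"] step
    by auto
  then obtain s where s: "s 0 = 0" "\<And>k. s k < s (Suc k)" "\<And>k. tail k (s k) (s (Suc k))"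
    by metis
  have sm: "strict_mono s" using s(2) by (simp add: strict_mono_Suc_iff)
  define C where "C k = F (s (Suc k)) - F (s k)" for k
  have CF: "C k \<subseteq> F (s n)" if "k < n" for k n
    using that monoF[of "s (Suc k)" "s n"] sm by (auto simp: C_def strict_mono_less_eq)
  have CC: "C k \<inter> C n = {}" if "k \<noteq> n" for k n
    using CF[of k n] CF[of n k] that by (cases "k < n") (auto simp: C_def)
  have UC: "(\<Union>k. C k) = I"
  proof (intro subset_antisym subsetI)
    fix i assume i: "i \<in> I"
    \<comment> \<open>A strictly increasing \<open>s\<close> satisfies \<open>n \<le> s n\<close>;
      the \<open>Suc\<close> matches the strict inequality in \<open>F\<close>.\<close>
    have "i \<in> F (s (Suc (to_nat_on I i)))"
      using i strict_mono_imp_increasing[OF sm, of "Suc (to_nat_on I i)"] by (simp add: F_def)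
    moreover have "i \<in> (\<Union>k. C k)" if "i \<in> F (s n)" for n
      using that
    proof (induction n)
      case 0
      then show ?case by (simp add: s(1) F_def)
    next
      case (Suc n)
      then show ?case by (cases "i \<in> F (s n)") (auto simp: C_def)
    qed
    ultimately show "i \<in> (\<Union>k. C k)" by blast
  qed (auto simp: C_def F_def)
  \<comment> \<open>The even blocks are \<open>r = 0\<close>, the odd ones
    \<open>r = 1\<close>.\<close>
  have part: "\<exists>g. finite_orthogonal_decomposition smul ip (\<Union>m. C (2 * m + r)) g \<and>
      perturbation smul \<epsilon> (\<Union>m. C (2 * m + r)) g f" for r
  proof (rule block_gram_schmidt[where \<delta> = "\<lambda>m. \<epsilon> / 2 ^ Suc m"])
    show "finite (C (2 * m + r))" for m
      using finF by (simp add: C_def)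
    show "disjoint_family (\<lambda>m. C (2 * m + r))"
      unfolding disjoint_family_on_def using CC by auto
  next
    fix m E assume E: "finite E" "orthonormal E" "E \<subseteq> span (f ` (\<Union>k<m. C (2 * k + r)))"
    show "(\<Sum>i\<in>C (2 * m + r). (norm (proj E (f i)))\<^sup>2) \<le> \<epsilon> / 2 ^ Suc m"
    proof (cases m)
      \<comment> \<open>With no earlier blocks the span is zero, so every projection
        vanishes.\<close>
      case 0
      with E(3) have "E \<subseteq> {0}" by simp
      then have "proj E x = 0" for x
        unfolding proj_def by (intro sum.neutral) auto
      then show ?thesis using assms(6) by simp
    next
      case (Suc l)
      \<comment> \<open>\<open>C k\<close> is the separating block just before the current one.
        Earlier blocks of this part lie in \<open>F (s k)\<close>, the current one outside
        \<open>F (s (Suc k))\<close>, so \<open>tail\<close> applies at \<open>k\<close>.\<close>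
      define k where "k = 2 * l + r + 1"
      have k: "2 * m + r = Suc k" "m \<le> k" using Suc by (auto simp: k_def)
      have "(\<Union>k<m. C (2 * k + r)) \<subseteq> F (s k)"
        using CF Suc by (intro UN_least) (simp add: k_def)
      then have "E \<subseteq> span (f ` F (s k))"
        using E(3) span_mono[of "f ` (\<Union>k<m. C (2 * k + r))" "f ` F (s k)"] by blast
      moreover have "C (2 * m + r) \<subseteq> I - F (s (Suc k))" "finite (C (2 * m + r))"
        using finF by (auto simp: k(1) C_def F_def)
      ultimately have "(\<Sum>i\<in>C (2 * m + r). (norm (proj E (f i)))\<^sup>2) \<le> \<epsilon> / 2 ^ Suc k"
        using s(3)[of k] E(1,2) unfolding tail_def by blast
      also have "\<dots> \<le> \<epsilon> / 2 ^ Suc m"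
        using k(2) assms(6) by (intro divide_left_mono power_increasing) auto
      finally show ?thesis .
    qed
  next
    fix N
    have "(\<Sum>m<N. \<epsilon> / 2 ^ Suc m) = \<epsilon> * (1 - 1 / 2 ^ N)"
      by (induction N) (auto simp: field_simps)
    also have "\<dots> \<le> \<epsilon>"
      using assms(6) by (simp add: mult_le_cancel_left1)
    finally show "(\<Sum>m<N. \<epsilon> / 2 ^ Suc m) \<le> \<epsilon>" .
  qed
  show ?thesis
  proof (intro exI conjI)
    have "C k \<subseteq> (\<Union>m. C (2 * m + 0)) \<union> (\<Union>m. C (2 * m + 1))" for k
    proof (cases "even k")
      case True
      then have "C k = C (2 * (k div 2) + 0)" by simp
      then show ?thesis by blast
    next
      case False
      then have "C k = C (2 * (k div 2) + 1)" by simp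
      then show ?thesis by blast
    qed
    then show "I = (\<Union>m. C (2 * m + 0)) \<union> (\<Union>m. C (2 * m + 1))"
      unfolding UC[symmetric] by blast
    have "C (2 * m + 0) \<inter> C (2 * n + 1) = {}" for m n
      by (rule CC) presburger
    then show "(\<Union>m. C (2 * m + 0)) \<inter> (\<Union>m. C (2 * m + 1)) = {}"
      by blast
    show "\<forall>J \<in> {\<Union>m. C (2 * m + 0), \<Union>m. C (2 * m + 1)}. \<exists>g.
        finite_orthogonal_decomposition smul ip J g \<and> perturbation smul \<epsilon> J g f"
      using part[of 0] part[of 1] by simp
  qed
qed

end
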